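(* Let $\alpha=[a_0;a_1,a_2,\dots]$ be an (infinite) simple continued fraction with $a_0$ odd and all other $a_i$ ($i\ge1$) even, and let $q_i$ be the continuants of $\alpha$. Then for every nonzero integer $k$, $$R_k(\alpha) = q_{2k-1}[\![ k>0 ]\!] + \sum_{i=0}^{2|k|-2} q_i,$$ where the first term is read as $0$ when $k<0$.
   Context: For a real number $\alpha$ and an integer $N\ge 0$, $S_N(\alpha) := \sum_{n=1}^N (-1)^{\lfloor n\alpha\rfloor}$. For an integer $k$, the record-holder at $k$ is $R_k(\alpha)=\min\{N\ge 0 : S_N(\alpha)=k\}$ ($N$ ranging over integers). For a statement $Q$, $[\![ Q ]\!]$ equals $1$ if $Q$ is true and $0$ if $Q$ is false. In a simple continued fraction all $a_i$ are integers and $a_i$ is positive for $i>0$; $[a_0;a_1,a_2,\dots]=\lim_{r\to\infty}[a_0;a_1,\dots,a_r]$, where $[a_0]=a_0$ and $[a_0;a_1,\dots,a_r]=a_0+1/[a_1;a_2,\dots,a_r]$. This limit always exists and is irrational. The continuants $q_i$ of $\alpha$ are defined by $q_{-2}=1$, $q_{-1}=0$, $q_i=a_iq_{i-1}+q_{i-2}$ for $i\ge0$. *)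

theory Defs
  imports Complex_Main
begin

definition sign_sum :: "real \<Rightarrow> nat \<Rightarrow> real" where
  "sign_sum \<alpha> N = (\<Sum>n = 1..N. (-1) powi \<lfloor>real n * \<alpha>\<rfloor>)"

(* Meaningful only if the value k is attained; otherwise LEAST is unspecified. *)
definition record_holder :: "real \<Rightarrow> int \<Rightarrow> nat" where
  "record_holder \<alpha> k = (LEAST N. sign_sum \<alpha> N = of_int k)"

(* cfrac_fin a r = [a 0; a 1, ..., a r] *)
fun cfrac_fin :: "(nat \<Rightarrow> int) \<Rightarrow> nat \<Rightarrow> real" where
  "cfrac_fin a 0 = of_int (a 0)"
| "cfrac_fin a (Suc r) = of_int (a 0) + 1 / cfrac_fin (\<lambda>i. a (Suc i)) r"

definition cfrac :: "(nat \<Rightarrow> int) \<Rightarrow> real" where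
  "cfrac a = lim (cfrac_fin a)"

(* Continuants with the index shifted by 2: continuant_aux a n = q_(n-2). *)
fun continuant_aux :: "(nat \<Rightarrow> int) \<Rightarrow> nat \<Rightarrow> int" where
  "continuant_aux a 0 = 1"
| "continuant_aux a (Suc 0) = 0"
| "continuant_aux a (Suc (Suc n)) = a n * continuant_aux a (Suc n) + continuant_aux a n"

(* q_i for i >= -2, so q_(-2) = 1 and q_(-1) = 0; values for i < -2 are irrelevant. *)
definition continuant :: "(nat \<Rightarrow> int) \<Rightarrow> int \<Rightarrow> int" where
  "continuant a i = continuant_aux a (nat (i + 2))"

end

theory Submission
  imports Defs
begin

text \<open>Write $\alpha$ for the value of the continued fraction, $p_i / q_i$ for its convergents and
  $S_N$ for the sign sum. The signs have an almost periodic structure on the scale of every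
  continuant: $q_i \alpha$ is so close to the integer $p_i$ that
  $\lfloor (n + q_i) \alpha \rfloor = p_i + \lfloor n \alpha \rfloor$ whenever $0 < n < q_{i+1}$
  (lemma \<open>floor_shift\<close>, a one-sided form of the theorem of best approximation). The parity
  hypotheses make all $p_i$ with $i \ge -1$ odd, so translation by $q_i$ flips the signs, and
  $S_{N + q_i} = S_{q_i} - S_N$ for $0 \le N < q_{i+1}$ (lemma \<open>S_shift\<close>).

  Since $q_{i+1} = a_{i+1} q_i + q_{i-1}$ with $a_{i+1}$ even, these flips cancel in pairs and
  $S_{q_{i+1}} = S_{q_{i-1}}$; hence $S_{q_i}$ is $-1$ for even $i$ and $0$ for odd $i$
  (lemma \<open>S_at_continuant\<close>). So on passing from $N < q_i$ to $N < q_{i+1}$ the set of values of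
  $S$ is united with its reflection $x \mapsto S_{q_i} - x$, which adds exactly one value. The
  values therefore appear in the order $0, -1, 1, -2, 2, \dots$. Each of them is the reflection of
  the preceding one in this list, so its first occurrence lies exactly $q_i$ after that of its
  predecessor. Summing up, the $m$-th new value first occurs at $q_0 + \dots + q_{m-1}$, which is the
  claim with $m = 2k$ for $k > 0$ and $m = -2k - 1$ for $k < 0$.\<close>

section \<open>Numerators and denominators of the convergents\<close>

text \<open>The index is shifted by two, as for the continuants: \<open>numerator_aux a n\<close> is $p_{n-2}$, so that
  $p_{n-2} / q_{n-2}$ is a convergent for $n \ge 2$.\<close>

fun numerator_aux :: "(nat \<Rightarrow> int) \<Rightarrow> nat \<Rightarrow> int" where
  "numerator_aux a 0 = 0"
| "numerator_aux a (Suc 0) = 1"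
| "numerator_aux a (Suc (Suc n)) = a n * numerator_aux a (Suc n) + numerator_aux a n"

lemma convergents_det:
  "numerator_aux a (Suc n) * continuant_aux a n - numerator_aux a n * continuant_aux a (Suc n)
    = (-1) ^ n"
  by (induction n) (auto simp: algebra_simps)

text \<open>Continued fractions unfold at the front, continuants at the back. The next two lemmas give the
  front recursion for numerators and denominators: prepending a partial quotient multiplies the
  vector $(p, q)$ by a matrix.\<close>

lemma continuant_aux_Suc_shift:
  "continuant_aux a (Suc n) = numerator_aux (\<lambda>i. a (Suc i)) n"
  by (induction n rule: induct_nat_012) auto

lemma numerator_aux_Suc_shift:
  "numerator_aux a (Suc n)
    = a 0 * numerator_aux (\<lambda>i. a (Suc i)) n + continuant_aux (\<lambda>i. a (Suc i)) n"
  by (induction n rule: induct_nat_012) (auto simp: algebra_simps)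

text \<open>The simplifier would otherwise expand every index of the form $n + 2$.\<close>

declare numerator_aux.simps(3) [simp del] continuant_aux.simps(3) [simp del]

locale simple_cfrac =
  fixes a :: "nat \<Rightarrow> int"
  assumes pos: "i > 0 \<Longrightarrow> a i > 0"
begin

abbreviation p :: "nat \<Rightarrow> int" where "p \<equiv> numerator_aux a"
abbreviation q :: "nat \<Rightarrow> int" where "q \<equiv> continuant_aux a"

lemma q_pos: "q (n + 2) > 0"
proof (induction n rule: less_induct)
  case (less n)
  consider "n = 0" | "n = 1" | m where "n = m + 2"
    by (metis One_nat_def add_2_eq_Suc' not0_implies_Suc)
  then show ?case
  proof cases
    case 3
    then have "q (m + 3) > 0" "q (m + 2) > 0" "a (m + 2) > 0"
      using less[of "m + 1"] less[of m] pos[of "m + 2"] by (simp_all add: eval_nat_numeral)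
    moreover have "q (n + 2) = a (m + 2) * q (m + 3) + q (m + 2)"
      using 3 by (simp add: eval_nat_numeral continuant_aux.simps(3))
    ultimately show ?thesis
      by (metis add_pos_pos mult_pos_pos)
  qed (use pos[of 1] in \<open>auto simp: eval_nat_numeral continuant_aux.simps(3)\<close>)
qed

lemma q_nonneg: "n > 0 \<Longrightarrow> q n \<ge> 0"
proof (cases "n = 1")
  case False
  assume "n > 0"
  with False have "n - 2 + 2 = n" by simp
  then show ?thesis using q_pos[of "n - 2"] by simp
qed auto

lemma q_Suc_ge: "q (n + 3) \<ge> q (n + 2) + q (n + 1)"
proof -
  have "q (n + 3) = a (n + 1) * q (n + 2) + q (n + 1)"
    by (simp add: eval_nat_numeral continuant_aux.simps(3))
  moreover have "a (n + 1) * q (n + 2) \<ge> 1 * q (n + 2)"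
    using pos[of "n + 1"] q_pos[of n] by (intro mult_right_mono) auto
  ultimately show ?thesis by simp
qed

lemma q_mono: "q (n + 2) \<le> q (n + 3)"
  using q_Suc_ge[of n] q_nonneg[of "n + 1"] by simp

lemma q_ge: "q (n + 2) \<ge> int n"
proof (induction n)
  case (Suc n)
  show ?case
  proof (cases n)
    case 0
    then show ?thesis using q_pos[of 1] by simp
  next
    case (Suc m)
    then have "q (n + 3) \<ge> q (n + 2) + q (m + 2)"
      using q_Suc_ge[of n] by simp
    then show ?thesis using Suc.IH q_pos[of m] by (simp add: eval_nat_numeral)
  qed
qed (use q_pos[of 0] in auto)

end

lemma cfrac_fin_eq:
  assumes "\<And>i. i > 0 \<Longrightarrow> a i > 0"
  shows "cfrac_fin a n = numerator_aux a (n + 2) / continuant_aux a (n + 2)"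
  using assms
proof (induction n arbitrary: a)
  case 0
  then show ?case
    by (simp add: eval_nat_numeral numerator_aux.simps(3) continuant_aux.simps(3))
next
  case (Suc n)
  interpret simple_cfrac a using Suc.prems by unfold_locales
  let ?b = "\<lambda>i. a (Suc i)"
  have "cfrac_fin ?b n = numerator_aux ?b (n + 2) / continuant_aux ?b (n + 2)"
    using Suc.prems by (intro Suc.IH) auto
  moreover have "numerator_aux ?b (n + 2) > 0"
    using q_pos[of "Suc n"] continuant_aux_Suc_shift[of a "n + 2"] by simp
  moreover have "Suc n + 2 = Suc (n + 2)" by simp
  ultimately show ?case
    unfolding cfrac_fin.simps continuant_aux_Suc_shift[of a "n + 2"]
      numerator_aux_Suc_shift[of a "n + 2"] \<open>Suc n + 2 = Suc (n + 2)\<close>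
    by (simp add: field_simps)
qed


section \<open>The convergents alternate around the limit\<close>

context simple_cfrac
begin

lemma cfrac_fin_convergent: "cfrac_fin a n = p (n + 2) / q (n + 2)"
  using pos by (rule cfrac_fin_eq)

text \<open>By the determinant identity, consecutive convergents differ by $\pm 1/(q_n q_{n+1})$ with
  alternating signs, so the limit is an alternating series and the Leibniz criterion yields both its
  convergence and the side on which each convergent lies.\<close>

lemma cfrac_fin_leibniz:
  "cfrac_fin a n = a 0 + (\<Sum>i<n. (-1) ^ i * (1 / (q (i + 2) * q (i + 3))))"
proof (induction n)
  case (Suc n)
  have "p (n + 3) * q (n + 2) - p (n + 2) * q (n + 3) = (-1) ^ n"
    using convergents_det[of a "n + 2"] by (simp add: eval_nat_numeral)
  then have "real_of_int (p (n + 3)) * q (n + 2) - real_of_int (p (n + 2)) * q (n + 3) = (-1) ^ n"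
    by (metis of_int_diff of_int_minus of_int_mult of_int_power of_int_1)
  moreover have "real_of_int (q (n + 2)) > 0" "real_of_int (q (n + 3)) > 0"
    using q_pos[of n] q_pos[of "n + 1"] by (simp_all add: eval_nat_numeral)
  moreover have "Suc n + 2 = n + 3" by simp
  ultimately have "cfrac_fin a (Suc n) - cfrac_fin a n = (-1) ^ n * (1 / (q (n + 2) * q (n + 3)))"
    unfolding cfrac_fin_convergent \<open>Suc n + 2 = n + 3\<close>
    by (simp add: diff_frac_eq del: cfrac_fin.simps)
  then show ?case using Suc by simp
qed simp

lemma cfrac_between_convergents:
  shows "cfrac_fin a (2 * n) \<le> cfrac a" and "cfrac a \<le> cfrac_fin a (2 * n + 1)"
proof -
  define b where "b i = 1 / (real_of_int (q (i + 2)) * q (i + 3))" for i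
  have b_pos: "b i > 0" for i
    using q_pos[of i] q_pos[of "i + 1"] by (simp add: b_def eval_nat_numeral)
  have "b (Suc i) \<le> b i" for i
  proof -
    have "real_of_int (q (i + 2)) * q (i + 3) \<le> real_of_int (q (i + 3)) * q (i + 4)"
      using q_mono[of i] q_mono[of "i + 1"] q_pos[of i] q_pos[of "i + 1"]
      by (intro mult_mono) (simp_all add: eval_nat_numeral)
    moreover have "real_of_int (q (i + 2)) * q (i + 3) > 0"
      using q_pos[of i] q_pos[of "i + 1"]
      by (simp add: eval_nat_numeral)
    ultimately show ?thesis
      unfolding b_def by (simp add: frac_le eval_nat_numeral)
  qed
  then have mono: "monoseq b" by (auto simp: monoseq_Suc)
  have "b i \<le> inverse (real (Suc i))" for i
  proof -
    have "real_of_int (q (i + 2)) * q (i + 3) \<ge> 1 * real (Suc i)"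
    proof (rule mult_mono)
      show "real_of_int (q (i + 2)) \<ge> 1" using q_pos[of i] by linarith
      show "real_of_int (q (i + 3)) \<ge> real (Suc i)"
        using q_ge[of "Suc i"] by (simp add: eval_nat_numeral)
    qed (use q_pos[of i] in auto)
    then show ?thesis
      unfolding b_def inverse_eq_divide by (intro frac_le) auto
  qed
  then have "b \<longlonglongrightarrow> 0"
    using b_pos
    by (intro real_tendsto_sandwich[OF _ _ tendsto_const LIMSEQ_inverse_real_of_nat])
      (auto intro!: always_eventually less_imp_le)
  note leibniz = summable_Leibniz[OF this mono]
  have fin: "cfrac_fin a = (\<lambda>n. a 0 + (\<Sum>i<n. (-1) ^ i * b i))"
    by (auto simp: cfrac_fin_leibniz b_def fun_eq_iff)
  have "cfrac_fin a \<longlonglongrightarrow> a 0 + (\<Sum>i. (-1) ^ i * b i)"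
    unfolding fin using leibniz(1) by (intro tendsto_intros summable_LIMSEQ)
  then have lim: "cfrac a = a 0 + (\<Sum>i. (-1) ^ i * b i)"
    unfolding cfrac_def by (rule limI)
  show "cfrac_fin a (2 * n) \<le> cfrac a" and "cfrac a \<le> cfrac_fin a (2 * n + 1)"
    using leibniz(2) b_pos[of 0] unfolding lim unfolding fin by auto
qed

definition err :: "nat \<Rightarrow> real" where
  "err n = q n * cfrac a - p n"

lemma err_rec: "err (Suc (Suc n)) = a n * err (Suc n) + err n"
  by (simp add: err_def numerator_aux.simps(3) continuant_aux.simps(3) algebra_simps)

lemma err_sign_weak: "(-1) ^ n * err (n + 2) \<ge> 0"
proof -
  have q: "real_of_int (q (n + 2)) > 0" using q_pos[of n] by linarith
  show ?thesis
  proof (cases "even n")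
    case True
    then have "cfrac_fin a n \<le> cfrac a"
      using cfrac_between_convergents(1)[of "n div 2"] by simp
    then show ?thesis
      using True q unfolding cfrac_fin_convergent err_def
      by (simp add: field_simps)
  next
    case False
    then have "cfrac a \<le> cfrac_fin a n"
      using cfrac_between_convergents(2)[of "n div 2"] by simp
    then show ?thesis
      using False q unfolding cfrac_fin_convergent err_def
      by (simp add: field_simps)
  qed
qed

lemma err_det: "q (Suc n) * err n - q n * err (Suc n) = (-1) ^ n"
proof -
  have "q (Suc n) * err n - q n * err (Suc n) = of_int (p (Suc n) * q n - p n * q (Suc n))"
    by (simp add: err_def algebra_simps)
  then show ?thesis
    unfolding convergents_det by simp
qed

text \<open>The inequalities are strict. If \<open>err n\<close> were zero, the recurrence would make
  \<open>err (Suc (Suc n))\<close> a positive multiple of \<open>err (Suc n)\<close>; as these two have weakly opposite signs,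
  \<open>err (Suc n)\<close> would vanish as well, and the determinant identity excludes two consecutive zeros.\<close>

lemma err_sign: "n > 0 \<Longrightarrow> (-1) ^ n * err n > 0"
proof -
  assume "n > 0"
  show ?thesis
  proof (cases "n = 1")
    case True
    then show ?thesis by (simp add: err_def)
  next
    case False
    then obtain m where m: "n = m + 2"
      using \<open>n > 0\<close> by (metis One_nat_def add_2_eq_Suc' gr0_conv_Suc not0_implies_Suc)
    have w: "(-1) ^ n * err n \<ge> 0" "(-1) ^ n * err (Suc n) \<le> 0" "(-1) ^ n * err (Suc (Suc n)) \<ge> 0"
      using err_sign_weak[of m] err_sign_weak[of "Suc m"] err_sign_weak[of "Suc (Suc m)"]
      by (simp_all add: m eval_nat_numeral)
    have "err n \<noteq> 0"
    proof
      assume 0: "err n = 0"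
      have "(-1) ^ n * err (Suc (Suc n)) = a n * ((-1) ^ n * err (Suc n))"
        by (simp add: err_rec 0 mult.left_commute)
      then have "a n * ((-1) ^ n * err (Suc n)) \<ge> 0"
        using w(3) by linarith
      moreover have "real_of_int (a n) > 0"
        using pos[OF \<open>n > 0\<close>] by simp
      ultimately have "(-1) ^ n * err (Suc n) \<ge> 0"
        by (simp add: zero_le_mult_iff)
      then have "err (Suc n) = 0" using w(2) by simp
      then show False using err_det[of n] 0 by simp
    qed
    then show ?thesis using w(1)
      by (metis less_eq_real_def mult_eq_0_iff power_not_zero neg_equal_0_iff_equal zero_neq_one)
  qed
qed


section \<open>Translation by a continuant\<close>

text \<open>This is the theorem of best approximation, one-sided. Since the determinant is $\pm 1$, the
  lattice point $(n, b)$ is an integer combination, with coefficients $x$ and $y$, of two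
  consecutive pairs $(q, p)$. For $n$ in the given range $x$ and $y$ have opposite signs, or $y = 0$
  and $x > 0$. The two errors also have opposite signs, so the two contributions to
  \<open>n * cfrac a - b\<close> reinforce each other: its signed value is positive when $y \le 0$, and smaller
  than \<open>- ((-1) ^ j * err j)\<close> when $y > 0$.\<close>

lemma no_close_lattice_point:
  fixes n b :: int
  assumes "j > 0" "0 < n" "n < q (Suc j)"
    and "- ((-1) ^ j * err j) \<le> (-1) ^ j * (n * cfrac a - b)"
  shows "(-1) ^ j * (n * cfrac a - b) > 0"
proof -
  define s :: int where "s = (-1) ^ j"
  \<comment> \<open>Cramer's rule; the determinant $s$ is its own inverse.\<close>
  define x where "x = s * (n * p (Suc j) - b * q (Suc j))"
  define y where "y = s * (b * q j - n * p j)"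
  have ss: "s * s = 1" 
    unfolding s_def by (simp flip: power_mult_distrib)
  have det: "p (Suc j) * q j - p j * q (Suc j) = s"
    unfolding s_def by (rule convergents_det)
  have "x * q j + y * q (Suc j) = s * n * (p (Suc j) * q j - p j * q (Suc j))"
    by (simp add: x_def y_def algebra_simps)
  then have n: "n = x * q j + y * q (Suc j)"
    using ss unfolding det by (simp add: mult.assoc mult.left_commute)
  have "x * p j + y * p (Suc j) = s * b * (p (Suc j) * q j - p j * q (Suc j))"
    by (simp add: x_def y_def algebra_simps)
  then have b: "b = x * p j + y * p (Suc j)"
    using ss unfolding det by (simp add: mult.assoc mult.left_commute)
  define u where "u = (-1) ^ j * err j"
  define v where "v = - ((-1) ^ j * err (Suc j))"
  have uv: "u > 0" "v > 0"
    using err_sign[OF \<open>j > 0\<close>] err_sign[of "Suc j"] by (simp_all add: u_def v_def)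
  have comb: "(-1) ^ j * (n * cfrac a - b) = x * u - y * v"
    unfolding n b u_def v_def err_def
    by (simp add: algebra_simps)
  have qj: "q j \<ge> 0" using q_nonneg \<open>j > 0\<close> .
  show ?thesis
  proof (cases "y > 0")
    case True
    then have "y * q (Suc j) \<ge> 1 * q (Suc j)"
      using assms(2,3) by (intro mult_right_mono) auto
    then have "x * q j < 0" using n assms(3) by linarith
    then have "x < 0" using qj by (simp add: mult_less_0_iff)
    then have "x * u \<le> (-1) * u"
      using uv by (intro mult_right_mono) auto
    moreover have "y * v > 0" using True uv by simp
    ultimately show ?thesis using assms(4) unfolding comb u_def[symmetric] by linarith
  next
    case False
    then have "y * q (Suc j) \<le> 0"
      using assms(2,3) by (intro mult_nonpos_nonneg) auto
    then have "x * q j > 0" using n assms(2) by linarith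
    then have "x > 0" using qj by (simp add: zero_less_mult_iff)
    then have "x * u > 0" using uv by simp
    moreover have "y * v \<le> 0"
      using False uv by (intro mult_nonpos_nonneg) auto
    ultimately show ?thesis unfolding comb by linarith
  qed
qed

text \<open>Adding \<open>q j\<close> to \<open>n\<close> moves \<open>n * cfrac a\<close> by the integer \<open>p j\<close> and the tiny amount
  \<open>err j\<close>. An integer crossed by that tiny move would be a lattice point too close on the wrong
  side.\<close>

lemma floor_shift:
  fixes n :: int
  assumes "j > 0" "0 < n" "n < q (Suc j)"
  shows "\<lfloor>(n + q j) * cfrac a\<rfloor> = p j + \<lfloor>n * cfrac a\<rfloor>"
proof -
  define f where "f = \<lfloor>n * cfrac a\<rfloor>"
  have f: "of_int f \<le> n * cfrac a" "n * cfrac a < of_int f + 1"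
    unfolding f_def by linarith+
  have "\<lfloor>n * cfrac a + err j\<rfloor> = f"
  proof (cases "even j")
    case True
    have "n * cfrac a + err j < of_int (f + 1)"
      using no_close_lattice_point[OF assms, of "f + 1"] True f by fastforce
    moreover have "err j > 0" using err_sign[OF assms(1)] True by simp
    ultimately show ?thesis using f by (intro floor_unique) auto
  next
    case False
    have "n * cfrac a + err j \<ge> of_int f"
      using no_close_lattice_point[OF assms, of f] False f by fastforce
    moreover have "err j < 0" using err_sign[OF assms(1)] False by simp
    ultimately show ?thesis using f by (intro floor_unique) auto
  qed
  moreover have "(n + q j) * cfrac a = (n * cfrac a + err j) + of_int (p j)"
    by (simp add: err_def algebra_simps)
  ultimately show ?thesis unfolding f_def by simp
qed

end


section \<open>The sign sum when only the integer part is odd\<close>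

locale odd_even_cfrac = simple_cfrac +
  assumes odd0: "odd (a 0)" and even_pos: "i \<ge> 1 \<Longrightarrow> even (a i)"
begin

abbreviation S :: "nat \<Rightarrow> real" where "S \<equiv> sign_sum (cfrac a)"

lemma odd_p: "n > 0 \<Longrightarrow> odd (p n)"
proof (induction n rule: induct_nat_012)
  case (ge2 n)
  then show ?case using odd0 even_pos[of n] by (cases n) (auto simp: numerator_aux.simps(3))
qed auto

lemma S_Suc: "S (Suc N) = S N + (-1) powi \<lfloor>real (Suc N) * cfrac a\<rfloor>"
  by (simp add: sign_sum_def)

text \<open>As \<open>p j\<close> is odd, translation by \<open>q j\<close> flips every sign in the range of \<open>floor_shift\<close>.\<close>

lemma S_shift:
  assumes "j > 0" "int N < q (Suc j)"
  shows "S (N + nat (q j)) = S (nat (q j)) - S N"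
  using assms(2)
proof (induction N)
  case 0
  then show ?case by (simp add: sign_sum_def)
next
  case (Suc N)
  have qj: "q j \<ge> 0" using q_nonneg assms(1) .
  have "\<lfloor>real (Suc (N + nat (q j))) * cfrac a\<rfloor> = \<lfloor>(int (Suc N) + q j) * cfrac a\<rfloor>"
    using qj by (simp add: algebra_simps)
  also have "\<dots> = p j + \<lfloor>int (Suc N) * cfrac a\<rfloor>"
    using floor_shift[OF assms(1), of "int (Suc N)"] Suc.prems by simp
  finally have "(-1) powi \<lfloor>real (Suc (N + nat (q j))) * cfrac a\<rfloor>
      = - ((-1) powi \<lfloor>real (Suc N) * cfrac a\<rfloor> :: real)"
    using odd_p[OF assms(1)] by (simp add: power_int_minus_left)
  then show ?case using Suc by (simp add: S_Suc)
qed

text \<open>Two consecutive translations cancel. The hypothesis is about the starting point of the last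
  of the $2m$ translations.\<close>

lemma S_shift_even:
  assumes "j > 0" "int (N + (2 * m - 1) * nat (q j)) < q (Suc j)"
  shows "S (N + 2 * m * nat (q j)) = S N"
  using assms(2)
proof (induction m)
  case (Suc m)
  let ?Q = "nat (q j)"
  have "2 * m * ?Q \<le> (2 * Suc m - 1) * ?Q" "(2 * m - 1) * ?Q \<le> (2 * Suc m - 1) * ?Q"
    by (intro mult_right_mono; simp)+
  then have *: "int (N + 2 * m * ?Q) < q (Suc j)" "int (N + (2 * m - 1) * ?Q) < q (Suc j)"
    using Suc.prems by linarith+
  have "N + 2 * Suc m * ?Q = (N + 2 * m * ?Q + ?Q) + ?Q"
    by simp
  moreover have "int (N + 2 * m * ?Q + ?Q) < q (Suc j)"
    using Suc.prems by (simp add: algebra_simps)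
  ultimately have "S (N + 2 * Suc m * ?Q) = S ?Q - S (N + 2 * m * ?Q + ?Q)"
    using S_shift[OF assms(1), of "N + 2 * m * ?Q + ?Q"] by metis
  also have "\<dots> = S (N + 2 * m * ?Q)"
    using S_shift[OF assms(1) *(1)] by simp
  finally show ?case using Suc.IH[OF *(2)] by simp
qed auto

text \<open>Every partial quotient after the first is even, so $q_{i+1}$ arises from $q_{i-1}$ by an even
  number of translations by $q_i$; these cancel in pairs.
  The induction can start at $q_{-1} = 0$ and $q_0 = 1$.\<close>

lemma S_at_continuant: "S (nat (q (Suc n))) = (if even n then 0 else -1)"
proof (induction n rule: induct_nat_012)
  case 0
  then show ?case by (simp add: sign_sum_def)
next
  case 1
  \<comment> \<open>The signs of the errors of $p_0 / q_0$ and $p_1 / q_1$ locate the limit strictly between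
    \<open>a 0\<close> and \<open>a 0 + 1\<close>.\<close>
  have "real_of_int (a 1) \<ge> 1" using pos[of 1] by simp
  moreover have "cfrac a > a 0"
    using err_sign[of 2]
    by (simp add: err_def eval_nat_numeral numerator_aux.simps(3) continuant_aux.simps(3))
  moreover have "a 1 * cfrac a < a 1 * a 0 + 1"
    using err_sign[of 3]
    by (simp add: err_def eval_nat_numeral numerator_aux.simps(3) continuant_aux.simps(3))
  ultimately have "a 1 * (cfrac a - a 0) < a 1 * (1::real)"
    by (simp add: algebra_simps)
  then have "cfrac a < a 0 + 1"
    using \<open>real_of_int (a 1) \<ge> 1\<close> by (simp add: mult_less_cancel_left_pos)
  then have "\<lfloor>cfrac a\<rfloor> = a 0"
    using \<open>cfrac a > a 0\<close> by (intro floor_unique) auto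
  then show ?case
    using odd0 by (simp add: sign_sum_def power_int_minus_left continuant_aux.simps(3))
next
  case (ge2 n)
  have "a (Suc n) > 0" "even (a (Suc n))" using pos even_pos by auto
  define m where "m = nat (a (Suc n) div 2)"
  have am: "a (Suc n) = 2 * int m" "m > 0"
    using \<open>a (Suc n) > 0\<close> \<open>even (a (Suc n))\<close> by (auto simp: m_def)
  have Q: "q (Suc n) \<ge> 0" "q (Suc (Suc n)) > 0"
    using q_nonneg[of "Suc n"] q_pos[of n] by simp_all
  have rec: "q (Suc (Suc (Suc n))) = 2 * int m * q (Suc (Suc n)) + q (Suc n)"
    unfolding continuant_aux.simps(3)[of a "Suc n"] am by (rule refl)
  have nat_rec: "nat (q (Suc (Suc (Suc n)))) = nat (q (Suc n)) + 2 * m * nat (q (Suc (Suc n)))"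
    unfolding rec using Q
    by (simp add: nat_add_distrib nat_mult_distrib)
  have "int (nat (q (Suc n)) + (2 * m - 1) * nat (q (Suc (Suc n)))) < q (Suc (Suc (Suc n)))"
    unfolding rec using Q am(2)
    by (simp add: of_nat_diff left_diff_distrib)
  then show ?case
    unfolding nat_rec using S_shift_even[of "Suc (Suc n)"] ge2 by simp
qed


section \<open>Ranges and records\<close>

lemma S_reflect:
  assumes "int N < q (n + 3)"
  shows "S (N + nat (q (n + 2))) = (if even n then -1 else 0) - S N"
  using S_shift[of "n + 2" N] S_at_continuant[of "n + 1"] assms
  by (simp add: numeral_3_eq_3)

text \<open>For $q_m \le N < q_{m+1}$ the value $S_N$ is the reflection of the earlier value $S_{N - q_m}$.
  The reflection maps the new interval onto itself: the interval grows by one at its lower end for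
  even $m$, where the reflection is $x \mapsto -1 - x$, and at its upper end for odd $m$, where it is
  $x \mapsto -x$.\<close>

lemma S_range:
  assumes "int N < q (m + 2)"
  shows "- real ((m + 1) div 2) \<le> S N \<and> S N \<le> real (m div 2)"
  using assms
proof (induction m arbitrary: N)
  case 0
  then show ?case by (simp add: sign_sum_def eval_nat_numeral continuant_aux.simps(3))
next
  case (Suc m)
  from Suc.prems show ?case
  proof (induction N rule: less_induct)
    case (less N)
    show ?case
    proof (cases "int N < q (m + 2)")
      case True
      have "real ((m + 1) div 2) \<le> real ((Suc m + 1) div 2)" "real (m div 2) \<le> real (Suc m div 2)"
        by (auto intro!: div_le_mono)
      then show ?thesis using Suc.IH[OF True] by linarith
    next
      case False
      define M where "M = N - nat (q (m + 2))"
      have M: "N = M + nat (q (m + 2))" "M < N"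
        using False q_pos[of m] unfolding M_def by linarith+
      have "int M < q (m + 3)" "int M < q (Suc m + 2)"
        using less.prems M by (simp_all add: eval_nat_numeral)
      then have "S N = (if even m then -1 else 0) - S M"
        "- real ((Suc m + 1) div 2) \<le> S M \<and> S M \<le> real (Suc m div 2)"
        using S_reflect[of M m] less.IH[OF M(2)] M(1) by simp_all
      then show ?thesis by (cases "even m") (auto elim!: evenE oddE)
    qed
  qed
qed

text \<open>The values of the sign sum in their order of appearance: $0, -1, 1, -2, 2, \dots$\<close>

definition record_value :: "nat \<Rightarrow> int" where
  "record_value m = (if even m then int (m div 2) else - int ((m + 1) div 2))"

lemma record_value_Suc: "record_value (Suc m) = (if even m then -1 else 0) - record_value m"
  by (auto simp: record_value_def elim!: evenE oddE)

lemma record_value_Suc_outside: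
  "record_value (Suc m) < - int ((m + 1) div 2) \<or> record_value (Suc m) > int (m div 2)"
  by (auto simp: record_value_def elim!: evenE oddE)

definition record_pos :: "nat \<Rightarrow> nat" where
  "record_pos m = (\<Sum>i<m. nat (q (i + 2)))"

lemma record_pos_less: "int (record_pos m) < q (m + 2)"
proof (induction m)
  case 0
  then show ?case by (simp add: record_pos_def eval_nat_numeral continuant_aux.simps(3))
next
  case (Suc m)
  have "a (Suc m) \<ge> 2"
    using pos[of "Suc m"] even_pos[of "Suc m"] by presburger
  then have "a (Suc m) * q (m + 2) \<ge> 2 * q (m + 2)"
    using q_pos[of m] by (intro mult_right_mono) auto
  moreover have "q (Suc m + 2) = a (Suc m) * q (m + 2) + q (m + 1)"
    by (simp add: continuant_aux.simps(3))
  moreover have "q (m + 1) \<ge> 0" using q_nonneg[of "m + 1"] by simp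
  ultimately have "q (Suc m + 2) \<ge> 2 * q (m + 2)" by linarith
  moreover have "int (record_pos (Suc m)) = int (record_pos m) + q (m + 2)"
    using q_pos[of m] by (simp add: record_pos_def)
  ultimately show ?case using Suc by linarith
qed

lemma S_record_pos: "S (record_pos m) = record_value m"
proof (induction m)
  case 0
  then show ?case by (simp add: record_pos_def record_value_def sign_sum_def)
next
  case (Suc m)
  have "q (m + 2) \<le> q (m + 3)" by (rule q_mono)
  then have "S (record_pos m + nat (q (m + 2))) = (if even m then -1 else 0) - S (record_pos m)"
    using record_pos_less[of m] by (intro S_reflect) linarith
  then show ?case
    using Suc by (simp add: record_pos_def record_value_Suc)
qed

text \<open>By the range lemma \<open>record_value (Suc m)\<close> does not occur before \<open>q (m + 2)\<close>. From there up to
  \<open>q (m + 3)\<close> every occurrence is the reflection of an occurrence of \<open>record_value m\<close>, to which the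
  induction hypothesis applies, and later occurrences lie beyond the claimed position anyway.\<close>

lemma record_pos_le: "S N = record_value m \<Longrightarrow> record_pos m \<le> N"
proof (induction m arbitrary: N)
  case 0
  then show ?case by (simp add: record_pos_def)
next
  case (Suc m)
  show ?case
  proof (cases "int N < q (m + 3)")
    case True
    have "\<not> int N < q (m + 2)"
    proof
      assume "int N < q (m + 2)"
      then have "- int ((m + 1) div 2) \<le> record_value (Suc m) \<and>
          record_value (Suc m) \<le> int (m div 2)"
        using S_range[of N m] unfolding Suc.prems by linarith
      then show False using record_value_Suc_outside[of m] by linarith
    qed
    define M where "M = N - nat (q (m + 2))"
    have M: "N = M + nat (q (m + 2))"
      using \<open>\<not> int N < q (m + 2)\<close> unfolding M_def by linarith
    have "S N = (if even m then -1 else 0) - S M"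
      unfolding M using True M by (intro S_reflect) linarith
    then have "S M = record_value m"
      using Suc.prems by (simp add: record_value_Suc split: if_splits)
    then have "record_pos m \<le> M" by (rule Suc.IH)
    then show ?thesis by (simp add: M record_pos_def)
  next
    case False
    then show ?thesis using record_pos_less[of "Suc m"] by (simp add: eval_nat_numeral)
  qed
qed

lemma record_holder_record: "record_holder (cfrac a) (record_value m) = record_pos m"
  unfolding record_holder_def using S_record_pos record_pos_le by (intro Least_equality) auto

lemma int_record_pos: "int (record_pos m) = (\<Sum>i = 0..int m - 1. continuant a i)"
proof (induction m)
  case (Suc m)
  have "{0..int (Suc m) - 1} = insert (int m) {0..int m - 1}" by auto
  moreover have "int (nat (q (m + 2))) = continuant a (int m)"
    using q_pos[of m] by (simp add: continuant_def nat_add_distrib)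
  ultimately show ?case
    using Suc by (simp add: record_pos_def)
qed (simp add: record_pos_def)

end

theorem corollary4p5:
  fixes a :: "nat \<Rightarrow> int" and \<alpha> :: real and k :: int
  assumes "\<And>i. i > 0 \<Longrightarrow> a i > 0"
    and "\<alpha> = cfrac a"
    and "odd (a 0)"
    and "\<And>i. i \<ge> 1 \<Longrightarrow> even (a i)"
    and "k \<noteq> 0"
  shows "(\<exists>N. sign_sum \<alpha> N = of_int k) \<and>
    int (record_holder \<alpha> k) =
      continuant a (2 * k - 1) * of_bool (k > 0) + (\<Sum>i = 0..2 * \<bar>k\<bar> - 2. continuant a i)"
proof -
  interpret odd_even_cfrac a
    using assms by unfold_locales auto
  define m where "m = nat (if k > 0 then 2 * k else - 2 * k - 1)"
  have k: "record_value m = k"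
    using \<open>k \<noteq> 0\<close> by (auto simp: record_value_def m_def even_nat_iff)
  have "int (record_pos m) =
      continuant a (2 * k - 1) * of_bool (k > 0) + (\<Sum>i = 0..2 * \<bar>k\<bar> - 2. continuant a i)"
  proof (cases "k > 0")
    case True
    then have "{0..int m - 1} = insert (2 * k - 1) {0..2 * \<bar>k\<bar> - 2}"
      by (auto simp: m_def)
    then show ?thesis using True by (simp add: int_record_pos)
  next
    case False
    then have "int m - 1 = 2 * \<bar>k\<bar> - 2"
      using \<open>k \<noteq> 0\<close> by (simp add: m_def)
    then show ?thesis using False unfolding int_record_pos \<open>int m - 1 = 2 * \<bar>k\<bar> - 2\<close> by simp
  qed
  then show ?thesis
    using S_record_pos[of m] record_holder_record[of m] unfolding k assms(2) by auto
qed

end
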